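(* Let $\gamma>0$, let $n\ge 1$ and let $X_1,\dots,X_n$ be i.i.d. random variables with the $\Gamma(\gamma)$ distribution. For every positive integer $k$, the function $$(a_1,\dots,a_n)\mapsto \mathbb{E}\left(\sum_{j=1}^n\sqrt{a_j}\,(X_j-\gamma)\right)^k$$ is Schur-convex on $\mathbb{R}_+^n$.
   Context: The $\Gamma(\gamma)$ distribution is the distribution on $\mathbb{R}$ with density $\Gamma(\gamma)^{-1}x^{\gamma-1}e^{-x}\mathbf{1}_{(0,\infty)}(x)$; its mean is $\gamma$. Here $\mathbb{R}_+=[0,\infty)$. A vector $a\in\mathbb{R}^n$ is majorised by $b\in\mathbb{R}^n$ if $\sum_j a_j=\sum_j b_j$ and, for each $k\le n$, the sum of the $k$ largest coordinates of $a$ is at most the sum of the $k$ largest coordinates of $b$. A function $F$ is Schur-convex on a permutation-invariant set $D$ if $F(a)\le F(b)$ whenever $a,b\in D$ and $a$ is majorised by $b$. *)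

theory Defs
  imports "HOL-Probability.Probability"
begin

definition gamma_density :: "real \<Rightarrow> real \<Rightarrow> real" where
  "gamma_density \<gamma> x = x powr (\<gamma> - 1) * exp (- x) / Gamma \<gamma> * indicator {0<..} x"

definition decreasing_rearrangement :: "real ^ 'n \<Rightarrow> real list" where
  "decreasing_rearrangement a =
     rev (sorted_list_of_multiset (image_mset (($) a) (mset_set UNIV)))"

definition sum_largest :: "nat \<Rightarrow> real ^ 'n \<Rightarrow> real" where
  "sum_largest k a = sum_list (take k (decreasing_rearrangement a))"

definition majorised_by :: "real ^ 'n \<Rightarrow> real ^ 'n \<Rightarrow> bool" where
  "majorised_by a b \<longleftrightarrow>
     (\<Sum>j\<in>UNIV. a $ j) = (\<Sum>j\<in>UNIV. b $ j) \<and>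
     (\<forall>k \<le> CARD('n). sum_largest k a \<le> sum_largest k b)"

(* Meaningful for permutation-invariant D only; invariance is left to the user of the definition. *)
definition schur_convex_on :: "(real ^ 'n) set \<Rightarrow> (real ^ 'n \<Rightarrow> real) \<Rightarrow> bool" where
  "schur_convex_on D F \<longleftrightarrow> (\<forall>a\<in>D. \<forall>b\<in>D. majorised_by a b \<longrightarrow> F a \<le> F b)"

end

theory Submission
  imports Defs
begin

text \<open>The idea is to pass from moments to cumulants. For \<open>m \<ge> 2\<close> the \<open>m\<close>-th cumulant of
  \<open>S = (\<Sum>j. sqrt (a\<^sub>j) * (X\<^sub>j - \<gamma>))\<close> is \<open>\<gamma> (m-1)!\<close> times the power sum of the
  \<open>a\<^sub>j powr (m/2)\<close>, and the first cumulant is \<open>0\<close>. Since \<open>m/2 \<ge> 1\<close>, the function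
  \<open>x \<mapsto> x powr (m/2)\<close> is convex on \<open>[0, \<infinity>)\<close>, so by Karamata's inequality every cumulant is
  Schur-convex (\<open>sum_sqrt_power_mono_majorised\<close>); it is also nonnegative. Moments are polynomials
  in the cumulants with nonnegative coefficients, hence they inherit the monotonicity.

  Cumulants enter only through a formal power series: if \<open>F\<close> is the exponential generating
  function of the moments of \<open>S\<close>, its logarithmic derivative \<open>G\<close>, determined by \<open>F' = F G\<close>, is
  the derivative of the cumulant generating function. Comparing coefficients in \<open>F' = F G\<close> gives
  the recursion that carries the induction on the order of the moment
  (\<open>fps_log_deriv_mono\<close>). Working formally avoids any question of convergence of moment
  generating functions.

  Two facts identify \<open>G\<close>. Independence makes \<open>F\<close> a product over \<open>j\<close> (\<open>moment_fps_sum\<close>), so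
  logarithmic derivatives add. For a single summand, the identity
  \<open>E (X - \<gamma>) p(X) = E X p'(X)\<close> for polynomials \<open>p\<close> (\<open>gamma_stein\<close>) yields a two-term recursion
  for the moments, which says that \<open>(1 - s t) F' = \<gamma> s\<^sup>2 t F\<close>
  (\<open>centred_gamma_log_deriv\<close>).\<close>

section \<open>Karamata's inequality\<close>

text \<open>Summation by parts in the form of an induction: as the weights decrease and the partial sums are
  nonnegative, replacing all weights by the last one can only decrease the sum. With total sum zero
  this makes the weighted sum nonnegative.\<close>

lemma last_weight_le_weighted_sum:
  fixes c d :: "nat \<Rightarrow> real"
  assumes "\<And>i. i < n \<Longrightarrow> c (Suc i) \<le> c i"
    and "\<And>k. k \<le> n \<Longrightarrow> 0 \<le> (\<Sum>i<k. d i)"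
  shows "c n * (\<Sum>i<Suc n. d i) \<le> (\<Sum>i<Suc n. c i * d i)"
  using assms
proof (induction n)
  case 0
  then show ?case by simp
next
  case (Suc n)
  have "c (Suc n) * (\<Sum>i<Suc n. d i) \<le> c n * (\<Sum>i<Suc n. d i)"
    using Suc.prems(1)[of n] Suc.prems(2)[of "Suc n"] by (intro mult_right_mono) auto
  also have "\<dots> \<le> (\<Sum>i<Suc n. c i * d i)"
    by (rule Suc.IH) (use Suc.prems in auto)
  finally show ?case
    by (simp only: sum.lessThan_Suc[of _ "Suc n"] distrib_left add_right_mono)
qed

lemma sum_list_map_take_eq_sum:
  fixes f :: "'a \<Rightarrow> real"
  assumes "k \<le> length xs"
  shows "sum_list (map f (take k xs)) = (\<Sum>i<k. f (xs ! i))"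
  using assms by (subst sum_list_sum_nth) (simp add: atLeast0LessThan)

text \<open>Since \<open>xs\<close> is sorted, the slopes \<open>g\<close> along \<open>xs\<close> decrease, and the subgradient
  inequality bounds the increase of \<open>f\<close> below by the sum of the \<open>g (xs ! i) * (ys ! i - xs ! i)\<close>,
  which is nonnegative by summation by parts. Convexity enters through the pair of a function and a
  monotone subgradient on the points at hand, which spares one-sided derivatives at the boundary
  of the domain.\<close>

lemma karamata_list:
  fixes f g :: "real \<Rightarrow> real"
  assumes len: "length xs = length ys"
    and sorted: "sorted_wrt (\<ge>) xs"
    and partial: "\<And>k. k \<le> length xs \<Longrightarrow> sum_list (take k xs) \<le> sum_list (take k ys)"
    and total: "sum_list xs = sum_list ys"
    and subgradient: "\<And>x y. x \<in> set xs \<Longrightarrow> y \<in> set ys \<Longrightarrow> f x + g x * (y - x) \<le> f y"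
    and mono: "mono_on (set xs) g"
  shows "sum_list (map f xs) \<le> sum_list (map f ys)"
proof (cases "length xs")
  case 0
  then show ?thesis using len by simp
next
  case (Suc n)
  define d where "d i = ys ! i - xs ! i" for i
  have d_sum: "(\<Sum>i<k. d i) = sum_list (take k ys) - sum_list (take k xs)"
    if "k \<le> length xs" for k
    using sum_list_map_take_eq_sum[OF that, of "\<lambda>x. x"]
      sum_list_map_take_eq_sum[of k ys "\<lambda>x. x"] that len
    by (simp add: d_def sum_subtractf)
  have "0 = g (xs ! n) * (\<Sum>i<Suc n. d i)"
    using d_sum[of "Suc n"] total Suc len by simp
  also have "\<dots> \<le> (\<Sum>i<Suc n. g (xs ! i) * d i)"
  proof (rule last_weight_le_weighted_sum)
    fix i assume "i < n"
    then show "g (xs ! Suc i) \<le> g (xs ! i)"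
      using Suc sorted by (intro mono_onD[OF mono]) (auto simp: sorted_wrt_iff_nth_less)
  next
    fix k assume "k \<le> n"
    then show "0 \<le> (\<Sum>i<k. d i)"
      using d_sum[of k] partial[of k] Suc by simp
  qed
  also have "\<dots> \<le> (\<Sum>i<Suc n. f (ys ! i) - f (xs ! i))"
  proof (rule sum_mono)
    fix i assume "i \<in> {..<Suc n}"
    then show "g (xs ! i) * d i \<le> f (ys ! i) - f (xs ! i)"
      using subgradient[of "xs ! i" "ys ! i"] Suc len by (simp add: d_def)
  qed
  also have "\<dots> = sum_list (map f ys) - sum_list (map f xs)"
    using sum_list_map_take_eq_sum[of "Suc n" xs f] sum_list_map_take_eq_sum[of "Suc n" ys f] Suc len
    by (simp add: sum_subtractf del: sum.lessThan_Suc)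
  finally show ?thesis by simp
qed

lemma mset_decreasing_rearrangement:
  "mset (decreasing_rearrangement a) = image_mset (($) a) (mset_set UNIV)"
  by (simp add: decreasing_rearrangement_def)

lemma sum_list_decreasing_rearrangement:
  fixes f :: "real \<Rightarrow> real"
  shows "sum_list (map f (decreasing_rearrangement a)) = (\<Sum>j\<in>UNIV. f (a $ j))"
  by (simp flip: sum_mset_sum_list add: mset_decreasing_rearrangement image_mset.compositionality
      comp_def sum_unfold_sum_mset)

lemma length_decreasing_rearrangement:
  "length (decreasing_rearrangement (a :: real ^ 'n)) = CARD('n)"
  by (simp flip: size_mset add: mset_decreasing_rearrangement)

lemma set_decreasing_rearrangement:
  "set (decreasing_rearrangement a) = range (($) a)"
  by (simp flip: set_mset_mset add: mset_decreasing_rearrangement)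

lemma sorted_decreasing_rearrangement: "sorted_wrt (\<ge>) (decreasing_rearrangement a)"
  by (simp add: decreasing_rearrangement_def sorted_wrt_rev)

lemma karamata:
  fixes a b :: "real ^ 'n" and f g :: "real \<Rightarrow> real"
  assumes maj: "majorised_by a b"
    and "\<And>x y. x \<in> range (($) a) \<Longrightarrow> y \<in> range (($) b) \<Longrightarrow> f x + g x * (y - x) \<le> f y"
    and "mono_on (range (($) a)) g"
  shows "(\<Sum>j\<in>UNIV. f (a $ j)) \<le> (\<Sum>j\<in>UNIV. f (b $ j))"
  unfolding sum_list_decreasing_rearrangement[symmetric]
proof (rule karamata_list)
  show "sum_list (decreasing_rearrangement a) = sum_list (decreasing_rearrangement b)"
    using maj sum_list_decreasing_rearrangement[of "\<lambda>x. x" a]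
      sum_list_decreasing_rearrangement[of "\<lambda>x. x" b]
    by (simp add: majorised_by_def)
qed (use assms in \<open>auto simp: length_decreasing_rearrangement set_decreasing_rearrangement
      sorted_decreasing_rearrangement majorised_by_def sum_largest_def\<close>)

text \<open>With \<open>u = sqrt y\<close> and \<open>v = sqrt x\<close> this is the tangent line inequality at \<open>x\<close> for the convex
  function \<open>x \<mapsto> x powr ((n + 2) / 2)\<close>. Stated in the square roots it is an inequality between
  polynomials and covers \<open>x = 0\<close> too.\<close>

lemma power_tangent_inequality:
  fixes u v :: real
  assumes "0 \<le> u" "0 \<le> v"
  shows "real (n + 2) * v ^ n * u\<^sup>2 \<le> 2 * u ^ (n + 2) + n * v ^ (n + 2)"
proof (induction n)
  case 0
  then show ?case by (simp add: power2_eq_square)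
next
  case (Suc n)
  (* Passing from n to n + 1, the difference of the two sides is multiplied by v, and what remains
     is a product of two factors of the same sign. *)
  let ?D = "\<lambda>n::nat. 2 * u ^ (n + 2) + n * v ^ (n + 2) - (n + 2) * v ^ n * u\<^sup>2"
  let ?r = "(u - v) * ((u ^ (n + 2) - v ^ (n + 1) * u) + (u ^ (n + 2) - v ^ (n + 2)))"
  have step: "?D (Suc n) = v * ?D n + ?r"
    by (simp add: algebra_simps power2_eq_square)
  have "0 \<le> ?r"
  proof (cases "v \<le> u")
    case True
    then have "v ^ (n + 1) * u \<le> u ^ (n + 1) * u" "v ^ (n + 2) \<le> u ^ (n + 2)"
      using assms by (intro mult_right_mono power_mono; simp)+
    then show ?thesis
      using True by (intro mult_nonneg_nonneg add_nonneg_nonneg) (simp_all add: mult_ac)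
  next
    case False
    then have "u ^ (n + 1) * u \<le> v ^ (n + 1) * u" "u ^ (n + 2) \<le> v ^ (n + 2)"
      using assms by (intro mult_right_mono power_mono; simp)+
    then show ?thesis
      using False by (intro mult_nonpos_nonpos add_nonpos_nonpos) (simp_all add: mult_ac)
  qed
  moreover have "0 \<le> v * ?D n"
    using Suc assms by (intro mult_nonneg_nonneg) (simp_all add: add_ac)
  ultimately have "0 \<le> ?D (Suc n)" using step by linarith
  then show ?case by simp
qed

lemma sum_sqrt_power_mono_majorised:
  fixes a b :: "real ^ 'n"
  assumes "majorised_by a b" "\<And>j. 0 \<le> a $ j" "\<And>j. 0 \<le> b $ j" "2 \<le> m"
  shows "(\<Sum>j\<in>UNIV. sqrt (a $ j) ^ m) \<le> (\<Sum>j\<in>UNIV. sqrt (b $ j) ^ m)"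
proof -
  obtain n where m: "m = n + 2" using \<open>2 \<le> m\<close> by (metis le_add_diff_inverse2)
  (* The derivative of x powr (m / 2); for n = 0 the convention 0 ^ 0 = 1 gives the right slope 1
     at x = 0. *)
  let ?g = "\<lambda>x. (n + 2) / 2 * sqrt x ^ n"
  show ?thesis
  proof (rule karamata[where g = ?g, OF assms(1)])
    fix x y assume "x \<in> range (($) a)" "y \<in> range (($) b)"
    then have "0 \<le> x" "0 \<le> y" using assms by auto
    then have "(n + 2) * sqrt x ^ n * y \<le> 2 * sqrt y ^ m + n * (x * sqrt x ^ n)"
      and "sqrt x ^ m = x * sqrt x ^ n"
      using power_tangent_inequality[of "sqrt y" "sqrt x" n]
      by (simp_all add: m mult.assoc[symmetric] add_ac)
    then show "sqrt x ^ m + ?g x * (y - x) \<le> sqrt y ^ m" by (simp add: field_simps)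
  next
    show "mono_on (range (($) a)) ?g"
      by (rule mono_onI) (use assms in \<open>auto intro!: mult_left_mono power_mono\<close>)
  qed
qed

section \<open>Power series with a prescribed logarithmic derivative\<close>

lemma fps_log_deriv_prod:
  fixes F G :: "'i \<Rightarrow> 'a::comm_ring_1 fps"
  assumes "finite I" "\<And>i. i \<in> I \<Longrightarrow> fps_deriv (F i) = F i * G i"
  shows "fps_deriv (\<Prod>i\<in>I. F i) = (\<Prod>i\<in>I. F i) * (\<Sum>i\<in>I. G i)"
  using assms by (induction I rule: finite_induct) (simp_all add: algebra_simps)

text \<open>The equation \<open>F' = F * G\<close> reads \<open>(n + 1) F\<^sub>n\<^sub>+\<^sub>1 = (\<Sum>i\<le>n. F\<^sub>i G\<^sub>n\<^sub>-\<^sub>i)\<close>, so each coefficient of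
  \<open>F\<close> is a combination of earlier ones that is increasing in all the data, as long as these are
  nonnegative.\<close>

lemma fps_log_deriv_mono:
  fixes F G F' G' :: "'a::linordered_field fps"
  assumes F: "fps_deriv F = F * G" and F': "fps_deriv F' = F' * G'"
    and init: "0 \<le> fps_nth F 0" "fps_nth F 0 \<le> fps_nth F' 0"
    and le: "\<And>n. 0 \<le> fps_nth G n" "\<And>n. fps_nth G n \<le> fps_nth G' n"
  shows "0 \<le> fps_nth F n \<and> fps_nth F n \<le> fps_nth F' n"
proof (induction n rule: less_induct)
  case (less n)
  show ?case
  proof (cases n)
    case 0
    then show ?thesis using init by simp
  next
    case (Suc m)
    have rec: "fps_nth F n = (\<Sum>i=0..m. fps_nth F i * fps_nth G (m - i)) / of_nat n"
      using arg_cong[OF F, of "\<lambda>H. fps_nth H m"] Suc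
      by (simp add: fps_mult_nth field_simps del: of_nat_Suc)
    have rec': "fps_nth F' n = (\<Sum>i=0..m. fps_nth F' i * fps_nth G' (m - i)) / of_nat n"
      using arg_cong[OF F', of "\<lambda>H. fps_nth H m"] Suc
      by (simp add: fps_mult_nth field_simps del: of_nat_Suc)
    have IH: "0 \<le> fps_nth F i" "fps_nth F i \<le> fps_nth F' i" if "i \<le> m" for i
      using less.IH[of i] that Suc by auto
    have "0 \<le> fps_nth F' i" if "i \<le> m" for i
      using IH[OF that] by linarith
    then show ?thesis
      unfolding rec rec' using IH le
      by (auto intro!: divide_right_mono divide_nonneg_nonneg sum_nonneg sum_mono mult_mono)
  qed
qed

section \<open>Exponential generating functions of moments\<close>

definition moment_fps :: "'w measure \<Rightarrow> ('w \<Rightarrow> real) \<Rightarrow> real fps" where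
  "moment_fps M Y = Abs_fps (\<lambda>k. (\<integral>\<omega>. Y \<omega> ^ k \<partial>M) / fact k)"

definition has_all_moments :: "'w measure \<Rightarrow> ('w \<Rightarrow> real) \<Rightarrow> bool" where
  "has_all_moments M Y \<longleftrightarrow> (\<forall>k. integrable M (\<lambda>\<omega>. Y \<omega> ^ k))"

context prob_space
begin

text \<open>The binomial theorem turns independence into the product formula: dividing the \<open>k\<close>-th moment by
  \<open>k!\<close> absorbs the binomial coefficients and leaves a Cauchy product.\<close>

lemma moment_fps_add:
  assumes indep: "indep_var borel Y borel Z"
    and Y: "has_all_moments M Y" and Z: "has_all_moments M Z"
  shows "has_all_moments M (\<lambda>\<omega>. Y \<omega> + Z \<omega>)" (is ?I)
    and "moment_fps M (\<lambda>\<omega>. Y \<omega> + Z \<omega>) = moment_fps M Y * moment_fps M Z" (is ?E)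
proof -
  have pow: "indep_var borel (\<lambda>\<omega>. Y \<omega> ^ i) borel (\<lambda>\<omega>. Z \<omega> ^ j)" for i j
    using indep_var_compose[OF indep, of "\<lambda>x. x ^ i" borel "\<lambda>x. x ^ j" borel] by (simp add: comp_def)
  have int: "integrable M (\<lambda>\<omega>. Y \<omega> ^ i * Z \<omega> ^ j)" for i j
    using indep_var_integrable[OF pow] Y Z by (simp add: has_all_moments_def)
  have ex: "expectation (\<lambda>\<omega>. Y \<omega> ^ i * Z \<omega> ^ j) = expectation (\<lambda>\<omega>. Y \<omega> ^ i) * expectation (\<lambda>\<omega>. Z \<omega> ^ j)" for i j
    using indep_var_lebesgue_integral[OF pow] Y Z by (simp add: has_all_moments_def)
  have binom: "(Y \<omega> + Z \<omega>) ^ k = (\<Sum>i\<le>k. of_nat (k choose i) * (Y \<omega> ^ i * Z \<omega> ^ (k - i)))" for \<omega> k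
    by (subst binomial_ring) (simp add: mult.assoc)
  show ?I
    unfolding has_all_moments_def binom using int by (auto intro!: integrable_sum integrable_mult_right)
  show ?E
  proof (rule fps_ext)
    fix k
    have "expectation (\<lambda>\<omega>. (Y \<omega> + Z \<omega>) ^ k) / fact k
        = (\<Sum>i\<le>k. of_nat (k choose i) * (expectation (\<lambda>\<omega>. Y \<omega> ^ i) * expectation (\<lambda>\<omega>. Z \<omega> ^ (k - i)))) / fact k"
      unfolding binom using int by (simp add: ex)
    also have "\<dots> = (\<Sum>i\<le>k. expectation (\<lambda>\<omega>. Y \<omega> ^ i) / fact i * (expectation (\<lambda>\<omega>. Z \<omega> ^ (k - i)) / fact (k - i)))"
      by (auto simp: sum_divide_distrib binomial_fact intro!: sum.cong)
    finally show "fps_nth (moment_fps M (\<lambda>\<omega>. Y \<omega> + Z \<omega>)) k = fps_nth (moment_fps M Y * moment_fps M Z) k"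
      by (simp add: moment_fps_def fps_mult_nth atMost_atLeast0)
  qed
qed

lemma moment_fps_sum:
  fixes Y :: "'i \<Rightarrow> 'a \<Rightarrow> real"
  assumes "finite I" "indep_vars (\<lambda>_. borel) Y I" "\<And>i. i \<in> I \<Longrightarrow> has_all_moments M (Y i)"
  shows "has_all_moments M (\<lambda>\<omega>. \<Sum>i\<in>I. Y i \<omega>)
    \<and> moment_fps M (\<lambda>\<omega>. \<Sum>i\<in>I. Y i \<omega>) = (\<Prod>i\<in>I. moment_fps M (Y i))"
  using assms
proof (induction I rule: finite_induct)
  case empty
  have "moment_fps M (\<lambda>\<omega>. 0) = 1"
    by (rule fps_ext) (simp add: moment_fps_def power_0_left prob_space)
  then show ?case by (simp add: has_all_moments_def)
next
  case (insert i I)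
  have IH: "has_all_moments M (\<lambda>\<omega>. \<Sum>i\<in>I. Y i \<omega>)"
    "moment_fps M (\<lambda>\<omega>. \<Sum>i\<in>I. Y i \<omega>) = (\<Prod>i\<in>I. moment_fps M (Y i))"
    using insert.IH indep_vars_subset[OF insert.prems(1)] insert.prems(2) by auto
  note add = moment_fps_add[OF indep_vars_sum[OF insert.hyps insert.prems(1)]
      insert.prems(2)[OF insertI1] IH(1)]
  show ?case using add IH(2) insert.hyps by simp
qed

section \<open>Moments of the centred Gamma distribution\<close>

lemma gamma_moment:
  assumes "\<gamma> > 0" and D: "distributed M lborel X (gamma_density \<gamma>)"
  shows "integrable M (\<lambda>\<omega>. X \<omega> ^ m)"
    and "expectation (\<lambda>\<omega>. X \<omega> ^ m) = Gamma (\<gamma> + m) / Gamma \<gamma>"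
proof -
  have pos: "Gamma \<gamma> > 0" "Gamma (\<gamma> + m) > 0"
    using \<open>\<gamma> > 0\<close> by (auto intro!: Gamma_real_pos)
  have nonneg: "0 \<le> gamma_density \<gamma> x" for x
    using pos by (simp add: gamma_density_def)
  have eq: "gamma_density \<gamma> x * x ^ m
      = inverse (Gamma \<gamma>) * (indicator {0..} x * x powr (\<gamma> + m - 1) / exp x)" if "x \<noteq> 0" for x
    using that by (auto simp: gamma_density_def indicator_def exp_minus field_simps powr_add
        powr_diff powr_realpow)
  have "has_bochner_integral lborel (\<lambda>x::real. indicator {0..} x * x powr (\<gamma> + m - 1) / exp x) (Gamma (\<gamma> + m))"
    using Gamma_conv_nn_integral_real[of "\<gamma> + m"] \<open>\<gamma> > 0\<close> pos
    by (intro has_bochner_integral_nn_integral) auto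
  then have "has_bochner_integral lborel
      (\<lambda>x. inverse (Gamma \<gamma>) * (indicator {0..} x * x powr (\<gamma> + m - 1) / exp x))
      (inverse (Gamma \<gamma>) * Gamma (\<gamma> + m))"
    by (rule has_bochner_integral_mult_right)
  moreover have "AE x in lborel. inverse (Gamma \<gamma>) * (indicator {0..} x * x powr (\<gamma> + m - 1) / exp x)
      = gamma_density \<gamma> x * x ^ m"
    using AE_lborel_singleton[of 0] by (rule AE_mp) (auto simp: eq)
  moreover have "(\<lambda>x. gamma_density \<gamma> x * x ^ m) \<in> borel_measurable lborel"
    unfolding gamma_density_def by measurable
  ultimately have "has_bochner_integral lborel (\<lambda>x. gamma_density \<gamma> x * x ^ m)
      (inverse (Gamma \<gamma>) * Gamma (\<gamma> + m))"
    by (subst (asm) has_bochner_integral_cong_AE) auto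
  then show "integrable M (\<lambda>\<omega>. X \<omega> ^ m)" "expectation (\<lambda>\<omega>. X \<omega> ^ m) = Gamma (\<gamma> + m) / Gamma \<gamma>"
    using distributed_integrable[OF D, of "\<lambda>x. x ^ m"] distributed_integral[OF D, of "\<lambda>x. x ^ m"] nonneg
    by (auto simp: has_bochner_integral_iff field_simps)
qed

lemma gamma_integrable_poly:
  assumes "\<gamma> > 0" "distributed M lborel X (gamma_density \<gamma>)"
  shows "integrable M (\<lambda>\<omega>. poly p (X \<omega>))"
  unfolding poly_altdef using gamma_moment(1)[OF assms] by auto

text \<open>Both sides are linear in \<open>p\<close>, and for \<open>p = x ^ i\<close> the claim is the functional equation of the
  Gamma function, \<open>E X ^ (i + 1) = (\<gamma> + i) * E X ^ i\<close>. It is the integration by parts against the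
  density of \<open>X\<close>, obtained here without handling boundary terms.\<close>

lemma gamma_stein:
  assumes "\<gamma> > 0" and D: "distributed M lborel X (gamma_density \<gamma>)"
  shows "expectation (\<lambda>\<omega>. (X \<omega> - \<gamma>) * poly p (X \<omega>)) = expectation (\<lambda>\<omega>. X \<omega> * poly (pderiv p) (X \<omega>))"
proof -
  note int = gamma_moment(1)[OF assms] and poly = gamma_integrable_poly[OF assms]
  have rec: "expectation (\<lambda>\<omega>. X \<omega> ^ Suc i) = (\<gamma> + i) * expectation (\<lambda>\<omega>. X \<omega> ^ i)" for i
  proof -
    have "Gamma (\<gamma> + Suc i) = (\<gamma> + i) * Gamma (\<gamma> + i)"
      using Gamma_plus1[of "\<gamma> + i"] \<open>\<gamma> > 0\<close> nonpos_Ints_nonpos[of "\<gamma> + i"] by (force simp: add_ac)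
    then show ?thesis by (simp add: gamma_moment(2)[OF assms] del: of_nat_Suc power_Suc)
  qed
  have p: "poly p x = (\<Sum>i\<le>degree p. coeff p i * x ^ i)" for x :: real
    by (rule poly_altdef)
  (* The extra factor x restores the degree lost by differentiation, so that both sides of the
     claim are combinations of the same monomials, without a negative exponent for i = 0. *)
  have xp': "x * poly (pderiv p) x = (\<Sum>i\<le>degree p. coeff p i * (i * x ^ i))" for x :: real
  proof -
    have "pderiv p = (\<Sum>i\<le>degree p. pderiv (monom (coeff p i) i))"
      using higher_pderiv_sum[of 1 "\<lambda>i. monom (coeff p i) i" "{..degree p}"]
      by (simp add: poly_as_sum_of_monoms)
    then have "x * poly (pderiv p) x = (\<Sum>i\<le>degree p. x * (i * coeff p i * x ^ (i - 1)))"
      by (simp add: poly_sum pderiv_monom poly_monom sum_distrib_left)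
    also have "\<dots> = (\<Sum>i\<le>degree p. coeff p i * (i * x ^ i))"
    proof (rule sum.cong[OF refl])
      fix i
      show "x * (i * coeff p i * x ^ (i - 1)) = coeff p i * (i * x ^ i)"
        by (cases i) auto
    qed
    finally show ?thesis .
  qed
  have "(X \<omega> - \<gamma>) * poly p (X \<omega>) - X \<omega> * poly (pderiv p) (X \<omega>)
      = (\<Sum>i\<le>degree p. coeff p i * (X \<omega> ^ Suc i - (\<gamma> + i) * X \<omega> ^ i))" for \<omega>
    unfolding xp' p sum_distrib_left sum_subtractf[symmetric] by (intro sum.cong) (auto simp: algebra_simps)
  then have "expectation (\<lambda>\<omega>. (X \<omega> - \<gamma>) * poly p (X \<omega>) - X \<omega> * poly (pderiv p) (X \<omega>)) = 0"
    using int by (simp add: rec del: power_Suc)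
  moreover have "integrable M (\<lambda>\<omega>. (X \<omega> - \<gamma>) * poly p (X \<omega>))" "integrable M (\<lambda>\<omega>. X \<omega> * poly (pderiv p) (X \<omega>))"
    using poly[of "[:-\<gamma>, 1:] * p"] poly[of "[:0, 1:] * pderiv p"] by (simp_all add: algebra_simps)
  ultimately show ?thesis by simp
qed

lemma centred_gamma_has_all_moments:
  assumes "\<gamma> > 0" "distributed M lborel X (gamma_density \<gamma>)"
  shows "has_all_moments M (\<lambda>\<omega>. s * (X \<omega> - \<gamma>))"
  using gamma_integrable_poly[OF assms, of "[:- (s * \<gamma>), s:] ^ _"]
  by (simp add: has_all_moments_def algebra_simps)

text \<open>Apply the previous identity to \<open>p = (s (x - \<gamma>)) ^ (k + 1)\<close> and rewrite the factor \<open>s X\<close> that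
  appears on the right as \<open>s (X - \<gamma>) + \<gamma> s\<close>.\<close>

lemma centred_gamma_moment_recursion:
  fixes s :: real
  assumes "\<gamma> > 0" "distributed M lborel X (gamma_density \<gamma>)"
  defines "m \<equiv> \<lambda>k. expectation (\<lambda>\<omega>. (s * (X \<omega> - \<gamma>)) ^ k)"
  shows "m (Suc 0) = 0"
    and "m (Suc (Suc k)) = Suc k * (s * m (Suc k) + \<gamma> * s\<^sup>2 * m k)"
proof -
  let ?Y = "\<lambda>\<omega>. s * (X \<omega> - \<gamma>)"
  have int: "integrable M (\<lambda>\<omega>. ?Y \<omega> ^ i)" for i
    using centred_gamma_has_all_moments[OF assms(1,2), of s] by (simp add: has_all_moments_def)
  show "m (Suc 0) = 0"
    using gamma_stein[OF assms(1,2), of 1] by (simp add: m_def)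
  let ?p = "[:- (s * \<gamma>), s:]"
  have poly: "poly ?p x = s * (x - \<gamma>)" for x by (simp add: algebra_simps)
  have "m (Suc (Suc k)) = s * expectation (\<lambda>\<omega>. (X \<omega> - \<gamma>) * poly (?p ^ Suc k) (X \<omega>))"
    unfolding m_def by (subst integral_mult_right_zero[symmetric]) (simp only: poly poly_power power_Suc[of _ "Suc k"] mult.assoc)
  also have "\<dots> = s * expectation (\<lambda>\<omega>. X \<omega> * (Suc k * (?Y \<omega> ^ k * s)))"
    unfolding gamma_stein[OF assms(1,2)]
    by (simp only: pderiv_power_Suc poly_mult poly_smult poly_power poly) (simp add: pderiv_pCons mult.assoc)
  also have "\<dots> = expectation (\<lambda>\<omega>. Suc k * (s * ?Y \<omega> ^ Suc k + \<gamma> * s\<^sup>2 * ?Y \<omega> ^ k))"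
    by (subst integral_mult_right_zero[symmetric], rule Bochner_Integration.integral_cong[OF refl])
      (simp add: algebra_simps power2_eq_square)
  also have "\<dots> = Suc k * (s * m (Suc k) + \<gamma> * s\<^sup>2 * m k)"
    unfolding m_def using int by (simp del: power_Suc of_nat_Suc)
  finally show "m (Suc (Suc k)) = Suc k * (s * m (Suc k) + \<gamma> * s\<^sup>2 * m k)" .
qed

end

text \<open>The derivative of the cumulant generating function \<open>- \<gamma> s t - \<gamma> ln (1 - s t)\<close> of
  \<open>s (X - \<gamma>)\<close>. The constant term vanishes because of the centring; without it, it
  would be \<open>\<gamma> s\<close>, a concave function of \<open>s\<^sup>2\<close>.\<close>

definition gamma_cumulant_fps :: "real \<Rightarrow> real \<Rightarrow> real fps" where
  "gamma_cumulant_fps \<gamma> s = Abs_fps (\<lambda>m. if m = 0 then 0 else \<gamma> * s ^ Suc m)"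

lemma gamma_cumulant_fps_eq:
  "(1 - fps_const s * fps_X) * gamma_cumulant_fps \<gamma> s = fps_const (\<gamma> * s\<^sup>2) * fps_X"
proof (rule fps_ext)
  fix n
  show "fps_nth ((1 - fps_const s * fps_X) * gamma_cumulant_fps \<gamma> s) n
      = fps_nth (fps_const (\<gamma> * s\<^sup>2) * fps_X) n"
    by (cases n) (auto simp: gamma_cumulant_fps_def algebra_simps power2_eq_square)
qed

text \<open>Multiplying by \<open>1 - s t\<close>, a nonzero element of an integral domain, turns both sides into
  \<open>\<gamma> s\<^sup>2 t F\<close>: the left-hand side by the recursion for the moments, the right-hand side because
  \<open>G\<close> is a geometric series.\<close>

lemma (in prob_space) centred_gamma_log_deriv:
  fixes s :: real
  assumes "\<gamma> > 0" "distributed M lborel X (gamma_density \<gamma>)"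
  defines "F \<equiv> moment_fps M (\<lambda>\<omega>. s * (X \<omega> - \<gamma>))"
  shows "fps_deriv F = F * gamma_cumulant_fps \<gamma> s"
proof -
  let ?q = "1 - fps_const s * fps_X :: real fps"
  note rec = centred_gamma_moment_recursion[OF assms(1,2), of s]
  have "?q * fps_deriv F = fps_const (\<gamma> * s\<^sup>2) * fps_X * F"
  proof (rule fps_ext)
    fix n
    show "fps_nth (?q * fps_deriv F) n = fps_nth (fps_const (\<gamma> * s\<^sup>2) * fps_X * F) n"
    proof (cases n)
      case 0
      then show ?thesis using rec(1) by (simp add: F_def moment_fps_def algebra_simps)
    next
      case (Suc k)
      define m where "m k = expectation (\<lambda>\<omega>. (s * (X \<omega> - \<gamma>)) ^ k)" for k
      have F: "fps_nth F i = m i / fact i" for i by (simp add: F_def moment_fps_def m_def)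
      have "fps_nth (?q * fps_deriv F) n = (m (Suc (Suc k)) - Suc k * s * m (Suc k)) / fact (Suc k)"
        by (simp add: Suc left_diff_distrib mult.assoc F field_simps del: of_nat_Suc)
      also have "\<dots> = \<gamma> * s\<^sup>2 * m k / fact k"
      proof -
        have "m (Suc (Suc k)) - Suc k * s * m (Suc k) = Suc k * (\<gamma> * s\<^sup>2 * m k)"
          unfolding m_def rec(2) by (simp add: algebra_simps del: power_Suc)
        then show ?thesis by (simp add: fact_Suc del: of_nat_Suc)
      qed
      finally show ?thesis by (simp add: Suc F mult.assoc)
    qed
  qed
  also have "\<dots> = ?q * (F * gamma_cumulant_fps \<gamma> s)"
    unfolding gamma_cumulant_fps_eq[symmetric] by (simp add: mult_ac)
  finally have "?q * fps_deriv F = ?q * (F * gamma_cumulant_fps \<gamma> s)" .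
  moreover have "fps_nth ?q 0 \<noteq> 0" by simp
  then have "?q \<noteq> 0" by (metis fps_zero_nth)
  ultimately show ?thesis by simp
qed

theorem theorem5:
  fixes \<gamma> :: real and k :: nat
    and M :: "'w measure" and X :: "'n::finite \<Rightarrow> 'w \<Rightarrow> real"
  assumes "\<gamma> > 0" and "k > 0"
    and "prob_space M"
    and "prob_space.indep_vars M (\<lambda>_. borel) X UNIV"
    and "\<And>j. distributed M lborel (X j) (gamma_density \<gamma>)"
  shows "schur_convex_on {a :: real ^ 'n. \<forall>j. a $ j \<ge> 0}
           (\<lambda>a. prob_space.expectation M (\<lambda>\<omega>. (\<Sum>j\<in>UNIV. sqrt (a $ j) * (X j \<omega> - \<gamma>)) ^ k))"
proof -
  interpret prob_space M by fact
  let ?S = "\<lambda>(a :: real ^ 'n) \<omega>. \<Sum>j\<in>UNIV. sqrt (a $ j) * (X j \<omega> - \<gamma>)"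
  let ?G = "\<lambda>a :: real ^ 'n. \<Sum>j\<in>UNIV. gamma_cumulant_fps \<gamma> (sqrt (a $ j))"
  have log_deriv: "fps_deriv (moment_fps M (?S a)) = moment_fps M (?S a) * ?G a" for a
  proof -
    have "indep_vars (\<lambda>_. borel) (\<lambda>j \<omega>. sqrt (a $ j) * (X j \<omega> - \<gamma>)) UNIV"
      by (rule indep_vars_compose2[OF assms(4)]) auto
    then have "moment_fps M (?S a) = (\<Prod>j\<in>UNIV. moment_fps M (\<lambda>\<omega>. sqrt (a $ j) * (X j \<omega> - \<gamma>)))"
      by (intro moment_fps_sum[THEN conjunct2] centred_gamma_has_all_moments[OF assms(1,5)] finite)
    then show ?thesis
      by (simp add: fps_log_deriv_prod centred_gamma_log_deriv[OF assms(1,5)])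
  qed
  have G_nth: "fps_nth (?G a) m = (if m = 0 then 0 else \<gamma> * (\<Sum>j\<in>UNIV. sqrt (a $ j) ^ Suc m))" for a m
    by (simp add: fps_sum_nth gamma_cumulant_fps_def sum_distrib_left)
  show ?thesis
    unfolding schur_convex_on_def
  proof (intro ballI impI)
    fix a b :: "real ^ 'n"
    assume ab: "a \<in> {a. \<forall>j. a $ j \<ge> 0}" "b \<in> {a. \<forall>j. a $ j \<ge> 0}" and maj: "majorised_by a b"
    have "fps_nth (moment_fps M (?S a)) k \<le> fps_nth (moment_fps M (?S b)) k"
    proof (rule fps_log_deriv_mono[THEN conjunct2, OF log_deriv log_deriv])
      fix m
      show "0 \<le> fps_nth (?G a) m"
        using ab \<open>\<gamma> > 0\<close> unfolding G_nth by (auto intro!: mult_nonneg_nonneg sum_nonneg)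
      show "fps_nth (?G a) m \<le> fps_nth (?G b) m"
        using ab \<open>\<gamma> > 0\<close> sum_sqrt_power_mono_majorised[OF maj, of "Suc m"] unfolding G_nth by auto
    qed (simp_all add: moment_fps_def prob_space)
    then show "expectation (\<lambda>\<omega>. ?S a \<omega> ^ k) \<le> expectation (\<lambda>\<omega>. ?S b \<omega> ^ k)"
      by (simp add: moment_fps_def divide_le_cancel)
  qed
qed

end
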